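(* Consider an extremal lifted trajectory $(s,x,y,\lambda_1,\lambda_2,\lambda_3,\lambda_{cost},u_{edge})$ in the edge control system on a closed interval $[t_0,t_1]$. Then the optimal control function $u_{edge}$ is bang-bang with finitely many switches. That is, the control function is equal almost everywhere to a piecewise constant function with values $u_{edge}(t)=\pm\frac12$ for all $t\in[t_0,t_1]$, with finitely many switches on $[t_0,t_1]$.
   Context: Edge control system: the state variables are $s,x,y:[t_0,t_1]\to\mathbb R$ with $y>0$ and $-1/\sqrt3<x<1/\sqrt3$; the control is a measurable function $u_{edge}:[t_0,t_1]\to[-\frac12,\frac12]$; the state equations are $$s'=1/y,\qquad x'=y,\qquad y'=f_2(x,y,u_{edge})=\frac{2\sqrt3\,y^2u_{edge}}{-1+2\sqrt3\,x\,u_{edge}};$$ the values of $(s,x,y)$ at both endpoints are prescribed, $t_0$ is fixed and $t_1$ is free; the cost to minimize is $\int_{t_0}^{t_1}\frac{x^2}{y}\,dt$. The Hamiltonian is $$\mathcal H=\lambda_1y+\lambda_2f_2(x,y,u_{edge})+\frac{\lambda_3}{y}+\lambda_{cost}\frac{x^2}{y}.$$ An extremal lifted trajectory is a trajectory together with a constant $\lambda_{cost}\le0$ and absolutely continuous $\lambda_1,\lambda_2,\lambda_3:[t_0,t_1]\to\mathbb R$ such that $(\lambda_1,\lambda_2,\lambda_3,\lambda_{cost})\neq0$ at every time, $\lambda_1'=-\partial\mathcal H/\partial x$, $\lambda_2'=-\partial\mathcal H/\partial y$, $\lambda_3'=-\partial\mathcal H/\partial s=0$, and for almost every $t$ the value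 $u_{edge}(t)$ maximizes $\mathcal H$ over $[-\frac12,\frac12]$, with $\mathcal H=0$ along the trajectory. *)

theory Defs
  imports "HOL-Analysis.Analysis"
begin

(* Absolute continuity of a real function on [a,b]; the library only has absolute continuity
   of measures. *)
definition abs_continuous_on_interval :: "real \<Rightarrow> real \<Rightarrow> (real \<Rightarrow> real) \<Rightarrow> bool" where
  "abs_continuous_on_interval a b f \<longleftrightarrow>
     (\<forall>\<epsilon>>0. \<exists>\<delta>>0. \<forall>(n::nat) c d.
        (\<forall>i<n. a \<le> c i \<and> c i \<le> d i \<and> d i \<le> b) \<longrightarrow>
        disjoint_family_on (\<lambda>i. {c i<..<d i}) {..<n} \<longrightarrow>
        (\<Sum>i<n. d i - c i) < \<delta> \<longrightarrow>
        (\<Sum>i<n. \<bar>f (d i) - f (c i)\<bar>) < \<epsilon>)"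

(* For a breakpoint sequence p 0 < ... < p n the values at the breakpoints are unrestricted. *)
definition piecewise_constant_on_interval :: "real \<Rightarrow> real \<Rightarrow> (real \<Rightarrow> real) \<Rightarrow> bool" where
  "piecewise_constant_on_interval a b v \<longleftrightarrow>
     (\<exists>(n::nat) p. p 0 = a \<and> p n = b \<and> (\<forall>i<n. p i < p (Suc i)) \<and>
        (\<forall>i<n. v constant_on {p i<..<p (Suc i)}))"

definition edge_f2 :: "real \<Rightarrow> real \<Rightarrow> real \<Rightarrow> real" where
  "edge_f2 x y u = 2 * sqrt 3 * y\<^sup>2 * u / (-1 + 2 * sqrt 3 * x * u)"

definition edge_running_cost :: "real \<Rightarrow> real \<Rightarrow> real" where
  "edge_running_cost x y = x\<^sup>2 / y"

(* The Hamiltonian does not depend on s; s is kept as an argument so that all three adjoint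
   equations below can be written as partial derivatives.  The multipliers l1, l2, l3 are paired
   with x, y, s in this order. *)
definition edge_hamiltonian ::
    "real \<Rightarrow> real \<Rightarrow> real \<Rightarrow> real \<Rightarrow> real \<Rightarrow> real \<Rightarrow> real \<Rightarrow> real \<Rightarrow> real" where
  "edge_hamiltonian s x y l1 l2 l3 lcost u =
     l1 * y + l2 * edge_f2 x y u + l3 / y + lcost * edge_running_cost x y"

(* Trajectories are absolutely continuous and satisfy the state equations almost everywhere,
   the control being merely measurable.  The prescribed endpoint values of (s,x,y) are
   P0 and P1. *)
definition edge_trajectory ::
    "real \<Rightarrow> real \<Rightarrow> real \<times> real \<times> real \<Rightarrow> real \<times> real \<times> real \<Rightarrow>
     (real \<Rightarrow> real) \<Rightarrow> (real \<Rightarrow> real) \<Rightarrow> (real \<Rightarrow> real) \<Rightarrow> (real \<Rightarrow> real) \<Rightarrow> bool" where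
  "edge_trajectory t0 t1 P0 P1 s x y u \<longleftrightarrow>
     (\<forall>t\<in>{t0..t1}. y t > 0 \<and> - 1 / sqrt 3 < x t \<and> x t < 1 / sqrt 3) \<and>
     u \<in> borel_measurable (lebesgue_on {t0..t1}) \<and>
     (\<forall>t\<in>{t0..t1}. u t \<in> {-1/2..1/2}) \<and>
     abs_continuous_on_interval t0 t1 s \<and>
     abs_continuous_on_interval t0 t1 x \<and>
     abs_continuous_on_interval t0 t1 y \<and>
     (AE t in lebesgue_on {t0..t1}.
        (s has_real_derivative 1 / y t) (at t within {t0..t1}) \<and>
        (x has_real_derivative y t) (at t within {t0..t1}) \<and>
        (y has_real_derivative edge_f2 (x t) (y t) (u t)) (at t within {t0..t1})) \<and>
     (s t0, x t0, y t0) = P0 \<and> (s t1, x t1, y t1) = P1"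

definition edge_extremal ::
    "real \<Rightarrow> real \<Rightarrow> real \<times> real \<times> real \<Rightarrow> real \<times> real \<times> real \<Rightarrow>
     (real \<Rightarrow> real) \<Rightarrow> (real \<Rightarrow> real) \<Rightarrow> (real \<Rightarrow> real) \<Rightarrow>
     (real \<Rightarrow> real) \<Rightarrow> (real \<Rightarrow> real) \<Rightarrow> (real \<Rightarrow> real) \<Rightarrow> real \<Rightarrow> (real \<Rightarrow> real) \<Rightarrow> bool" where
  "edge_extremal t0 t1 P0 P1 s x y l1 l2 l3 lcost u \<longleftrightarrow>
     edge_trajectory t0 t1 P0 P1 s x y u \<and>
     lcost \<le> 0 \<and>
     abs_continuous_on_interval t0 t1 l1 \<and>
     abs_continuous_on_interval t0 t1 l2 \<and>
     abs_continuous_on_interval t0 t1 l3 \<and>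
     (\<forall>t\<in>{t0..t1}. (l1 t, l2 t, l3 t, lcost) \<noteq> (0, 0, 0, 0)) \<and>
     (AE t in lebesgue_on {t0..t1}.
        (l1 has_real_derivative
           - deriv (\<lambda>\<xi>. edge_hamiltonian (s t) \<xi> (y t) (l1 t) (l2 t) (l3 t) lcost (u t)) (x t))
          (at t within {t0..t1}) \<and>
        (l2 has_real_derivative
           - deriv (\<lambda>\<eta>. edge_hamiltonian (s t) (x t) \<eta> (l1 t) (l2 t) (l3 t) lcost (u t)) (y t))
          (at t within {t0..t1}) \<and>
        (l3 has_real_derivative
           - deriv (\<lambda>\<sigma>. edge_hamiltonian \<sigma> (x t) (y t) (l1 t) (l2 t) (l3 t) lcost (u t)) (s t))
          (at t within {t0..t1})) \<and>
     (AE t in lebesgue_on {t0..t1}.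
        (\<forall>w\<in>{-1/2..1/2}.
           edge_hamiltonian (s t) (x t) (y t) (l1 t) (l2 t) (l3 t) lcost w
             \<le> edge_hamiltonian (s t) (x t) (y t) (l1 t) (l2 t) (l3 t) lcost (u t)) \<and>
        edge_hamiltonian (s t) (x t) (y t) (l1 t) (l2 t) (l3 t) lcost (u t) = 0)"

end

theory Submission
  imports Defs
begin

text \<open>
  Since \<open>edge_f2\<close> is strictly decreasing in the control, the maximum principle forces
  \<open>u = \<mp>1/2\<close> according to the sign of \<open>l2\<close>, so it suffices that \<open>l2\<close> has finitely many zeros.
  Using \<open>H = 0\<close> to eliminate \<open>l1\<close>, the product \<open>\<mu> = l2 \<cdot> y\<close> satisfies
  \<open>\<mu>' = 2 (l3 + lcost \<cdot> x\<^sup>2) / y\<close> almost everywhere. Here \<open>l3\<close> is constant and \<open>x\<close> is strictly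
  increasing, so either \<open>l3 = lcost = 0\<close>, when \<open>\<mu>\<close> is a constant which nontriviality forces to be
  nonzero, or the right-hand side vanishes at most twice. In the latter case \<open>\<mu>\<close> is strictly
  monotone between these points.
\<close>

section \<open>Absolutely continuous functions\<close>

lemma abs_continuous_on_intervalE:
  assumes "abs_continuous_on_interval a b f" "e > 0"
  obtains \<delta> where "\<delta> > 0"
    "\<And>(n::nat) c d. \<lbrakk>\<forall>i<n. a \<le> c i \<and> c i \<le> d i \<and> d i \<le> b;
       disjoint_family_on (\<lambda>i. {c i<..<d i}) {..<n}; (\<Sum>i<n. d i - c i) < \<delta>\<rbrakk>
       \<Longrightarrow> (\<Sum>i<n. \<bar>f (d i) - f (c i)\<bar>) < e"
proof -
  note * = assms(1)[unfolded abs_continuous_on_interval_def, rule_format, OF assms(2)]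
  from * show ?thesis
    by (elim exE conjE) (erule that, blast)
qed

lemma abs_continuous_on_interval_subset:
  assumes "abs_continuous_on_interval a b f" "a \<le> c" "d \<le> b"
  shows "abs_continuous_on_interval c d f"
  unfolding abs_continuous_on_interval_def
proof (intro allI impI)
  fix e :: real assume "e > 0"
  then obtain \<delta> where "\<delta> > 0" and \<delta>: "\<And>(n::nat) c d. \<forall>i<n. a \<le> c i \<and> c i \<le> d i \<and> d i \<le> b
      \<Longrightarrow> disjoint_family_on (\<lambda>i. {c i<..<d i}) {..<n} \<Longrightarrow> (\<Sum>i<n. d i - c i) < \<delta>
      \<Longrightarrow> (\<Sum>i<n. \<bar>f (d i) - f (c i)\<bar>) < e"
    using abs_continuous_on_intervalE[OF assms(1)] by blast
  show "\<exists>\<delta>>0. \<forall>(n::nat) p q. (\<forall>i<n. c \<le> p i \<and> p i \<le> q i \<and> q i \<le> d) \<longrightarrow>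
      disjoint_family_on (\<lambda>i. {p i<..<q i}) {..<n} \<longrightarrow> (\<Sum>i<n. q i - p i) < \<delta> \<longrightarrow>
      (\<Sum>i<n. \<bar>f (q i) - f (p i)\<bar>) < e"
  proof (intro exI[of _ \<delta>] conjI allI impI)
    fix n :: nat and p q
    assume pq: "\<forall>i<n. c \<le> p i \<and> p i \<le> q i \<and> q i \<le> d"
      and *: "disjoint_family_on (\<lambda>i. {p i<..<q i}) {..<n}" "(\<Sum>i<n. q i - p i) < \<delta>"
    have "\<forall>i<n. a \<le> p i \<and> p i \<le> q i \<and> q i \<le> b"
      using pq assms(2,3) by (meson order_trans)
    then show "(\<Sum>i<n. \<bar>f (q i) - f (p i)\<bar>) < e" using * by (rule \<delta>)
  qed (rule \<open>\<delta> > 0\<close>)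
qed

lemma abs_continuous_on_interval_minus:
  assumes "abs_continuous_on_interval a b f"
  shows "abs_continuous_on_interval a b (\<lambda>t. - f t)"
proof -
  have "\<bar>- f p - - f q\<bar> = \<bar>f p - f q\<bar>" for p q by simp
  then show ?thesis
    using assms unfolding abs_continuous_on_interval_def by simp
qed

lemma abs_continuous_on_interval_imp_continuous_on:
  assumes "abs_continuous_on_interval a b f"
  shows "continuous_on {a..b} f"
  unfolding continuous_on_iff
proof (intro ballI allI impI)
  fix t e :: real assume t: "t \<in> {a..b}" and "e > 0"
  then obtain \<delta> where "\<delta> > 0" and \<delta>: "\<And>(n::nat) c d. \<forall>i<n. a \<le> c i \<and> c i \<le> d i \<and> d i \<le> b
      \<Longrightarrow> disjoint_family_on (\<lambda>i. {c i<..<d i}) {..<n} \<Longrightarrow> (\<Sum>i<n. d i - c i) < \<delta>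
      \<Longrightarrow> (\<Sum>i<n. \<bar>f (d i) - f (c i)\<bar>) < e"
    using abs_continuous_on_intervalE[OF assms] by blast
  \<comment> \<open>A single interval with endpoints \<open>r\<close> and \<open>t\<close> is
    enough; \<open>min\<close> and \<open>max\<close> put them in order.\<close>
  have "dist (f r) (f t) < e" if "r \<in> {a..b}" "dist r t < \<delta>" for r
    using \<delta>[of 1 "\<lambda>_. min r t" "\<lambda>_. max r t"] that t
    by (cases "r \<le> t") (auto simp: disjoint_family_on_def dist_real_def abs_minus_commute)
  with \<open>\<delta> > 0\<close> show "\<exists>d>0. \<forall>r\<in>{a..b}. dist r t < d \<longrightarrow> dist (f r) (f t) < e"
    by blast
qed

lemma continuous_on_Icc_bounded:
  fixes f :: "real \<Rightarrow> real"
  assumes "continuous_on {a..b} f"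
  obtains B where "B > 0" "\<And>t. t \<in> {a..b} \<Longrightarrow> \<bar>f t\<bar> \<le> B"
proof -
  have "bounded (f ` {a..b})"
    using assms compact_continuous_image compact_imp_bounded by blast
  then show ?thesis
    using that unfolding bounded_pos by auto
qed

text \<open>Both factors are bounded on the compact interval, so increments of the product are
  controlled by increments of the factors.\<close>

lemma abs_continuous_on_interval_mult:
  assumes f: "abs_continuous_on_interval a b f" and g: "abs_continuous_on_interval a b g"
  shows "abs_continuous_on_interval a b (\<lambda>t. f t * g t)"
  unfolding abs_continuous_on_interval_def
proof (intro allI impI)
  fix e :: real assume "e > 0"
  obtain B where "B > 0" and B: "\<And>t. t \<in> {a..b} \<Longrightarrow> \<bar>f t\<bar> \<le> B"
    using continuous_on_Icc_bounded[OF abs_continuous_on_interval_imp_continuous_on[OF f]] by metis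
  obtain C where "C > 0" and C: "\<And>t. t \<in> {a..b} \<Longrightarrow> \<bar>g t\<bar> \<le> C"
    using continuous_on_Icc_bounded[OF abs_continuous_on_interval_imp_continuous_on[OF g]] by metis
  \<comment> \<open>Each tolerance is divided by the bound of the other factor, so that the two sums
    below contribute less than \<open>e / 2\<close> each.\<close>
  have "e / (2 * C) > 0" "e / (2 * B) > 0"
    using \<open>e > 0\<close> \<open>B > 0\<close> \<open>C > 0\<close> by auto
  obtain \<delta>1 where "\<delta>1 > 0" and \<delta>1: "\<And>(n::nat) c d. \<forall>i<n. a \<le> c i \<and> c i \<le> d i \<and> d i \<le> b
      \<Longrightarrow> disjoint_family_on (\<lambda>i. {c i<..<d i}) {..<n} \<Longrightarrow> (\<Sum>i<n. d i - c i) < \<delta>1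
      \<Longrightarrow> (\<Sum>i<n. \<bar>f (d i) - f (c i)\<bar>) < e / (2 * C)"
    using abs_continuous_on_intervalE[OF f \<open>e / (2 * C) > 0\<close>] by blast
  obtain \<delta>2 where "\<delta>2 > 0" and \<delta>2: "\<And>(n::nat) c d. \<forall>i<n. a \<le> c i \<and> c i \<le> d i \<and> d i \<le> b
      \<Longrightarrow> disjoint_family_on (\<lambda>i. {c i<..<d i}) {..<n} \<Longrightarrow> (\<Sum>i<n. d i - c i) < \<delta>2
      \<Longrightarrow> (\<Sum>i<n. \<bar>g (d i) - g (c i)\<bar>) < e / (2 * B)"
    using abs_continuous_on_intervalE[OF g \<open>e / (2 * B) > 0\<close>] by blast
  have "(\<Sum>i<n. \<bar>f (d i) * g (d i) - f (c i) * g (c i)\<bar>) < e"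
    if cd: "\<forall>i<n. a \<le> c i \<and> c i \<le> d i \<and> d i \<le> b"
      and disj: "disjoint_family_on (\<lambda>i. {c i<..<d i}) {..<n}"
      and len: "(\<Sum>i<n. d i - c i) < min \<delta>1 \<delta>2" for n :: nat and c d
  proof -
    have "\<bar>f (d i) * g (d i) - f (c i) * g (c i)\<bar>
        \<le> B * \<bar>g (d i) - g (c i)\<bar> + C * \<bar>f (d i) - f (c i)\<bar>" if "i < n" for i
    proof -
      have "d i \<in> {a..b}" "c i \<in> {a..b}" using cd that by (auto intro: order_trans)
      \<comment> \<open>The mixed product \<open>f (d i) * g (c i)\<close> is subtracted and
        added.\<close>
      have "f (d i) * g (d i) - f (c i) * g (c i)
          = f (d i) * (g (d i) - g (c i)) + g (c i) * (f (d i) - f (c i))"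
        by (simp add: algebra_simps)
      also have "\<bar>\<dots>\<bar> \<le> \<bar>f (d i)\<bar> * \<bar>g (d i) - g (c i)\<bar> + \<bar>g (c i)\<bar> * \<bar>f (d i) - f (c i)\<bar>"
        by (metis abs_mult abs_triangle_ineq)
      also have "\<dots> \<le> B * \<bar>g (d i) - g (c i)\<bar> + C * \<bar>f (d i) - f (c i)\<bar>"
        using B[OF \<open>d i \<in> _\<close>] C[OF \<open>c i \<in> _\<close>] by (intro add_mono mult_right_mono) auto
      finally show ?thesis .
    qed
    then have "(\<Sum>i<n. \<bar>f (d i) * g (d i) - f (c i) * g (c i)\<bar>)
        \<le> (\<Sum>i<n. B * \<bar>g (d i) - g (c i)\<bar> + C * \<bar>f (d i) - f (c i)\<bar>)"
      by (intro sum_mono) auto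
    also have "\<dots> = B * (\<Sum>i<n. \<bar>g (d i) - g (c i)\<bar>) + C * (\<Sum>i<n. \<bar>f (d i) - f (c i)\<bar>)"
      by (simp add: sum.distrib sum_distrib_left)
    also have "\<dots> < B * (e / (2 * B)) + C * (e / (2 * C))"
      using \<delta>1[OF cd disj] \<delta>2[OF cd disj] len \<open>B > 0\<close> \<open>C > 0\<close>
      by (intro add_strict_mono mult_strict_left_mono) auto
    also have "\<dots> = e"
      using \<open>B > 0\<close> \<open>C > 0\<close> by simp
    finally show ?thesis .
  qed
  note sum_less = this
  show "\<exists>\<delta>>0. \<forall>(n::nat) c d. (\<forall>i<n. a \<le> c i \<and> c i \<le> d i \<and> d i \<le> b) \<longrightarrow>
      disjoint_family_on (\<lambda>i. {c i<..<d i}) {..<n} \<longrightarrow> (\<Sum>i<n. d i - c i) < \<delta> \<longrightarrow>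
      (\<Sum>i<n. \<bar>f (d i) * g (d i) - f (c i) * g (c i)\<bar>) < e"
  proof (intro exI[of _ "min \<delta>1 \<delta>2"] conjI allI impI)
    show "min \<delta>1 \<delta>2 > 0" using \<open>\<delta>1 > 0\<close> \<open>\<delta>2 > 0\<close> by simp
  qed (rule sum_less)
qed

section \<open>Monotonicity from the sign of an almost everywhere derivative\<close>

text \<open>
  The increment is summed over a tagged division fine for a gauge that keeps intervals tagged in
  \<open>N\<close> inside an open set of small measure; absolute continuity controls those intervals, and the
  derivative at the tag controls the others.
\<close>
lemma abs_continuous_deriv_nonneg_imp_le:
  fixes f :: "real \<Rightarrow> real"
  assumes "a \<le> b" and ac: "abs_continuous_on_interval a b f" and N: "negligible N"
    and deriv: "\<And>t. t \<in> {a..b} - N \<Longrightarrow> \<exists>D\<ge>0. (f has_real_derivative D) (at t within {a..b})"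
  shows "f a \<le> f b"
proof -
  \<comment> \<open>The term \<open>e * (b - a)\<close> pays for intervals tagged outside
    \<open>N\<close>, the last \<open>e\<close> for those tagged in \<open>N\<close>.\<close>
  have main: "- e * (b - a) - e \<le> f b - f a" if "e > 0" for e
  proof -
    obtain \<delta> where "\<delta> > 0" and \<delta>: "\<And>(n::nat) c d. \<forall>i<n. a \<le> c i \<and> c i \<le> d i \<and> d i \<le> b
        \<Longrightarrow> disjoint_family_on (\<lambda>i. {c i<..<d i}) {..<n} \<Longrightarrow> (\<Sum>i<n. d i - c i) < \<delta>
        \<Longrightarrow> (\<Sum>i<n. \<bar>f (d i) - f (c i)\<bar>) < e"
      using abs_continuous_on_intervalE[OF ac] \<open>e > 0\<close> by blast
    have "N \<in> sets lebesgue"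
      using N negligible_iff_null_sets by blast
    \<comment> \<open>As \<open>N\<close> is null, \<open>U\<close> itself has measure below
      \<delta>, so disjoint intervals inside \<open>U\<close> change \<open>f\<close> by less than
      \<open>e\<close> in total.\<close>
    then obtain U where "open U" "N \<subseteq> U" and UN: "U - N \<in> lmeasurable"
        "emeasure lebesgue (U - N) < ennreal \<delta>"
      using sets_lebesgue_outer_open \<open>\<delta> > 0\<close> by metis
    have "U = (U - N) \<union> N" using \<open>N \<subseteq> U\<close> by blast
    have U: "U \<in> lmeasurable"
      using UN(1) negligible_imp_measurable[OF N] \<open>U = _\<close> by (metis fmeasurable.Un)
    have "measure lebesgue U = measure lebesgue (U - N)"
      by (rule measure_negligible_symdiff[symmetric])
         (use UN U N \<open>N \<subseteq> U\<close> in \<open>auto intro: negligible_subset\<close>)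
    also have "\<dots> < \<delta>"
      using UN \<open>\<delta> > 0\<close> by (simp add: emeasure_eq_measure2 ennreal_less_iff)
    finally have U_small: "measure lebesgue U < \<delta>" .
    \<comment> \<open>The gauge radius at \<open>t\<close>: on \<open>N\<close> the ball stays in
      \<open>U\<close>; at the other points of the interval the linear approximation with slope
      \<open>D\<close> has error at most \<open>e\<close> times the distance. Elsewhere any radius
      will do.\<close>
    have "\<exists>r>0. (t \<in> N \<longrightarrow> ball t r \<subseteq> U) \<and>
        (t \<in> {a..b} - N \<longrightarrow> (\<exists>D\<ge>0. \<forall>q\<in>{a..b}. \<bar>q - t\<bar> < r \<longrightarrow> \<bar>f q - f t - D * (q - t)\<bar> \<le> e * \<bar>q - t\<bar>))"
      for t
    proof (cases "t \<in> N")
      case True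
      then show ?thesis
        using \<open>open U\<close> \<open>N \<subseteq> U\<close> open_contains_ball by (metis DiffD2 subsetD)
    next
      case False
      show ?thesis
      proof (cases "t \<in> {a..b}")
        case True
        with False deriv[of t] obtain D where "D \<ge> 0"
          and "(f has_derivative (*) D) (at t within {a..b})"
          unfolding has_field_derivative_def by auto
        then show ?thesis
          using \<open>e > 0\<close> False unfolding has_derivative_within_alt real_norm_def by meson
      qed (use False in \<open>auto intro: exI[of _ 1]\<close>)
    qed
    then obtain r where r_pos: "\<And>t. r t > 0" and r_in: "\<And>t. t \<in> N \<Longrightarrow> ball t (r t) \<subseteq> U"
      and r_out: "\<And>t. t \<in> {a..b} - N \<Longrightarrow>
        \<exists>D\<ge>0. \<forall>q\<in>{a..b}. \<bar>q - t\<bar> < r t \<longrightarrow> \<bar>f q - f t - D * (q - t)\<bar> \<le> e * \<bar>q - t\<bar>"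
      by metis
    have "gauge (\<lambda>t. ball t (r t))"
      using r_pos by (simp add: gauge_def)
    then obtain p where p: "p tagged_division_of {a..b}" and fine: "(\<lambda>t. ball t (r t)) fine p"
      using fine_division_exists_real by metis
    note pD = tagged_division_ofD[OF p]
    have pK: "K = {Inf K..Sup K}" "Inf K \<le> t" "t \<le> Sup K" "a \<le> Inf K" "Sup K \<le> b"
      "K \<subseteq> ball t (r t)" if tK: "(t, K) \<in> p" for t K
    proof -
      obtain c d where K: "K = {c..d}" using pD(4)[OF tK] unfolding box_real by blast
      moreover have "t \<in> K" "K \<subseteq> {a..b}" using pD(2,3)[OF tK] .
      ultimately have "c \<le> d" "Inf K = c" "Sup K = d" by auto
      then show "K = {Inf K..Sup K}" "Inf K \<le> t" "t \<le> Sup K" "a \<le> Inf K" "Sup K \<le> b"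
        using K \<open>t \<in> K\<close> \<open>K \<subseteq> {a..b}\<close> by auto
      show "K \<subseteq> ball t (r t)" using fine tK unfolding fine_def by blast
    qed
    define p1 where "p1 = {z \<in> p. fst z \<notin> N}"
    define p2 where "p2 = {z \<in> p. fst z \<in> N}"
    have fin: "finite p1" "finite p2" and p12: "p = p1 \<union> p2" "p1 \<inter> p2 = {}"
      using pD(1) by (auto simp: p1_def p2_def)
    define \<Delta> where "\<Delta> = (\<lambda>z::real \<times> real set. f (Sup (snd z)) - f (Inf (snd z)))"
    define len where "len = (\<lambda>z::real \<times> real set. Sup (snd z) - Inf (snd z))"
    have "(\<Sum>z\<in>p. \<Delta> z) = f b - f a"
      using additive_tagged_division_1[OF \<open>a \<le> b\<close> p, of f] by (simp add: \<Delta>_def case_prod_beta)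
    then have split: "f b - f a = (\<Sum>z\<in>p1. \<Delta> z) + (\<Sum>z\<in>p2. \<Delta> z)"
      using fin p12 by (simp add: sum.union_disjoint)
    have len_nonneg: "len z \<ge> 0" if "z \<in> p" for z
      using pK(2,3)[of "fst z" "snd z"] that by (auto simp: len_def)
    have "- e * len z \<le> \<Delta> z" if "z \<in> p1" for z
    proof -
      obtain t K where z: "z = (t, K)" by force
      have tK: "(t, K) \<in> p" "t \<notin> N" using that by (auto simp: p1_def z)
      note K = pK[OF tK(1)]
      obtain D where "D \<ge> 0" and D: "\<And>q. q \<in> {a..b} \<Longrightarrow> \<bar>q - t\<bar> < r t \<Longrightarrow>
          \<bar>f q - f t - D * (q - t)\<bar> \<le> e * \<bar>q - t\<bar>"
        using r_out[of t] tK K by auto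
      have "Inf K \<in> K" "Sup K \<in> K" using K(1,2,3) by (metis atLeastAtMost_iff order_refl order_trans)+
      then have "\<bar>Inf K - t\<bar> < r t" "\<bar>Sup K - t\<bar> < r t"
        using subsetD[OF K(6)] by (metis abs_minus_commute dist_real_def mem_ball)+
      then have "\<bar>f (Inf K) - f t - D * (Inf K - t)\<bar> \<le> e * (t - Inf K)"
        "\<bar>f (Sup K) - f t - D * (Sup K - t)\<bar> \<le> e * (Sup K - t)"
        using D[of "Inf K"] D[of "Sup K"] K by auto
      \<comment> \<open>The tag lies between the endpoints and \<open>D\<close> is nonnegative, so
        the linear part can only raise the increment; the loss is at most
        \<open>e * len z\<close>.\<close>
      moreover have "D * (Sup K - t) \<ge> 0" "D * (t - Inf K) \<ge> 0"
        using \<open>D \<ge> 0\<close> K by auto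
      ultimately show ?thesis
        by (auto simp: \<Delta>_def len_def z algebra_simps)
    qed
    then have "- e * (\<Sum>z\<in>p1. len z) \<le> (\<Sum>z\<in>p1. \<Delta> z)"
      unfolding sum_distrib_left by (rule sum_mono)
    moreover have "(\<Sum>z\<in>p1. len z) \<le> (\<Sum>z\<in>p. len z)"
      using pD(1) p12 len_nonneg by (intro sum_mono2) auto
    moreover have "(\<Sum>z\<in>p. len z) = b - a"
      using additive_tagged_division_1[OF \<open>a \<le> b\<close> p, of "\<lambda>t. t"]
      by (simp add: len_def case_prod_beta)
    ultimately have sum1: "- e * (b - a) \<le> (\<Sum>z\<in>p1. \<Delta> z)"
      using \<open>e > 0\<close> by (smt (verit) minus_mult_left mult_left_mono)
    \<comment> \<open>Neighbouring intervals of the division may share an endpoint. Their interiors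
      are disjoint and have the same lengths.\<close>
    define I where "I = (\<lambda>z::real \<times> real set. {Inf (snd z)<..<Sup (snd z)})"
    have I_interior: "I z = interior (snd z)" if "z \<in> p" for z
      using pK(1)[of "fst z" "snd z"] that by (metis I_def interior_atLeastAtMost_real prod.collapse)
    have disjI: "I z \<inter> I w = {}" if "z \<in> p" "w \<in> p" "z \<noteq> w" for z w
      using pD(5)[of "fst z" "snd z" "fst w" "snd w"] that by (simp add: I_interior)
    have "(\<Sum>z\<in>p2. len z) = (\<Sum>z\<in>p2. measure lebesgue (I z))"
      using len_nonneg p12 by (intro sum.cong) (auto simp: I_def len_def)
    also have "\<dots> = measure lebesgue (\<Union>z\<in>p2. I z)"
      using fin(2) disjI p12 by (intro measure_UNION'[symmetric])
        (auto simp: pairwise_def disjnt_def I_def)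
    also have "\<dots> \<le> measure lebesgue U"
    proof (rule measure_mono_fmeasurable)
      show "(\<Union>z\<in>p2. I z) \<subseteq> U"
      proof
        fix q assume "q \<in> (\<Union>z\<in>p2. I z)"
        then obtain t K where tK: "(t, K) \<in> p" "t \<in> N" "q \<in> I (t, K)"
          by (auto simp: p2_def)
        then have "q \<in> K" using I_interior interior_subset by fastforce
        then show "q \<in> U" using pK(6)[OF tK(1)] r_in[OF tK(2)] by blast
      qed
      show "(\<Union>z\<in>p2. I z) \<in> sets lebesgue"
        using fin(2) by (intro sets.finite_UN) (auto simp: I_def)
    qed (rule U)
    finally have len2: "(\<Sum>z\<in>p2. len z) < \<delta>" using U_small by simp
    \<comment> \<open>Absolute continuity speaks of families indexed by an initial segment of the
      naturals, so \<open>p2\<close> is enumerated.\<close>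
    obtain h where h: "bij_betw h {..<card p2} p2"
      using ex_bij_betw_nat_finite[OF fin(2)] by (auto simp: atLeast0LessThan)
    have h_in: "h i \<in> p2" if "i < card p2" for i
      using h that by (auto simp: bij_betw_def)
    have "(\<Sum>i<card p2. \<bar>f (Sup (snd (h i))) - f (Inf (snd (h i)))\<bar>) < e"
    proof (rule \<delta>)
      show "\<forall>i<card p2. a \<le> Inf (snd (h i)) \<and> Inf (snd (h i)) \<le> Sup (snd (h i)) \<and> Sup (snd (h i)) \<le> b"
      proof (intro allI impI)
        fix i assume "i < card p2"
        then have "(fst (h i), snd (h i)) \<in> p" using h_in p12 by auto
        from pK[OF this] show "a \<le> Inf (snd (h i)) \<and> Inf (snd (h i)) \<le> Sup (snd (h i)) \<and> Sup (snd (h i)) \<le> b"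
          by (auto intro: order_trans)
      qed
      show "disjoint_family_on (\<lambda>i. {Inf (snd (h i))<..<Sup (snd (h i))}) {..<card p2}"
        unfolding disjoint_family_on_def
      proof (intro ballI impI)
        fix i j assume ij: "i \<in> {..<card p2}" "j \<in> {..<card p2}" "i \<noteq> j"
        then have "h i \<noteq> h j" using h by (auto simp: bij_betw_def inj_on_def)
        then show "{Inf (snd (h i))<..<Sup (snd (h i))} \<inter> {Inf (snd (h j))<..<Sup (snd (h j))} = {}"
          using disjI[of "h i" "h j"] h_in ij p12 by (auto simp: I_def)
      qed
      show "(\<Sum>i<card p2. Sup (snd (h i)) - Inf (snd (h i))) < \<delta>"
        using sum.reindex_bij_betw[OF h, of len] len2 by (simp add: len_def)
    qed
    then have "(\<Sum>z\<in>p2. \<bar>\<Delta> z\<bar>) < e"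
      using sum.reindex_bij_betw[OF h, of "\<lambda>z. \<bar>\<Delta> z\<bar>"] by (simp add: \<Delta>_def)
    then have "- e \<le> (\<Sum>z\<in>p2. \<Delta> z)"
      using sum_abs[of \<Delta> p2] by linarith
    with sum1 split show ?thesis by linarith
  qed
  show ?thesis
  proof (rule ccontr)
    assume "\<not> f a \<le> f b"
    \<comment> \<open>For this \<open>e\<close>, \<open>main\<close> allows a decrease of at most
      \<open>(f a - f b) / 2\<close>, half of the assumed one. The summand \<open>1\<close> keeps
      the denominator positive when \<open>a = b\<close>.\<close>
    define e where "e = (f a - f b) / (2 * (b - a + 1))"
    have "e > 0" using \<open>\<not> f a \<le> f b\<close> \<open>a \<le> b\<close> by (simp add: e_def)
    have "e * (b - a + 1) = (f a - f b) / 2"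
      using \<open>a \<le> b\<close> by (simp add: e_def field_simps)
    then show False
      using main[OF \<open>e > 0\<close>] \<open>\<not> f a \<le> f b\<close> by (simp add: algebra_simps)
  qed
qed

text \<open>The one-sided comparison applies to both \<open>f\<close> and its negative.\<close>

lemma abs_continuous_deriv_zero_imp_eq:
  assumes "a \<le> b" "abs_continuous_on_interval a b f" "negligible N"
    and "\<And>t. t \<in> {a..b} - N \<Longrightarrow> (f has_real_derivative 0) (at t within {a..b})"
  shows "f a = f b"
proof (rule antisym)
  show "f a \<le> f b"
    using assms by (intro abs_continuous_deriv_nonneg_imp_le[of a b f N]) auto
  have "- f a \<le> - f b"
    using assms abs_continuous_on_interval_minus
    by (intro abs_continuous_deriv_nonneg_imp_le[of a b "\<lambda>t. - f t" N])
       (force dest: DERIV_minus)+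
  then show "f b \<le> f a" by simp
qed

text \<open>A nondegenerate interval has positive measure. This supplies points at which almost
  everywhere conditions actually hold.\<close>

lemma Ioo_diff_negligible_nonempty:
  fixes a b :: real
  assumes "a < b" "negligible N"
  obtains t where "a < t" "t < b" "t \<notin> N"
proof -
  have "\<not> negligible {a<..<b}"
    using assms(1) negligible_interval(2)[of a b] by (simp add: box_real)
  then have "\<not> {a<..<b} \<subseteq> N" using assms(2) negligible_subset by blast
  then show ?thesis using that by (meson greaterThanLessThan_iff subsetI)
qed

text \<open>Weak monotonicity holds on every subinterval, so failure of the strict inequality would
  make \<open>f\<close> constant. At an interior point off \<open>N\<close> the derivative would
  then be both zero and positive.\<close>

lemma abs_continuous_deriv_pos_imp_less:
  fixes f :: "real \<Rightarrow> real"
  assumes "a < b" and ac: "abs_continuous_on_interval a b f" and N: "negligible N"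
    and deriv: "\<And>t. t \<in> {a..b} - N \<Longrightarrow> \<exists>D>0. (f has_real_derivative D) (at t within {a..b})"
  shows "f a < f b"
proof -
  have mono: "f c \<le> f d" if "a \<le> c" "c \<le> d" "d \<le> b" for c d
  proof (rule abs_continuous_deriv_nonneg_imp_le[of c d f, OF _ _ N])
    show "\<exists>D\<ge>0. (f has_real_derivative D) (at t within {c..d})" if "t \<in> {c..d} - N" for t
    proof -
      have "t \<in> {a..b} - N" "{c..d} \<subseteq> {a..b}" using that \<open>a \<le> c\<close> \<open>d \<le> b\<close> by auto
      then show ?thesis using deriv has_field_derivative_subset less_imp_le by metis
    qed
  qed (use that ac abs_continuous_on_interval_subset in auto)
  show ?thesis
  proof (rule ccontr)
    assume "\<not> f a < f b"
    then have const: "f t = f a" if "t \<in> {a..b}" for t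
      using mono[of a t] mono[of t b] that by auto
    obtain t where t: "a < t" "t < b" "t \<notin> N"
      using Ioo_diff_negligible_nonempty[OF \<open>a < b\<close> N] by metis
    then obtain D where "D > 0" "(f has_real_derivative D) (at t within {a..b})"
      using deriv[of t] by auto
    then have "(f has_real_derivative D) (at t)"
      using t by (simp add: at_within_Icc_at)
    moreover have "(f has_real_derivative 0) (at t)"
    proof (rule has_field_derivative_transform_within_open[of "\<lambda>_. f a" _ _ "{a<..<b}"])
      show "f a = f q" if "q \<in> {a<..<b}" for q using const[of q] that by auto
    qed (use t in auto)
    ultimately show False using DERIV_unique \<open>D > 0\<close> by blast
  qed
qed

section \<open>Finite zero sets\<close>

text \<open>Sending each point of \<open>Z\<close> to the set of elements of \<open>C\<close> below
  it is injective by separation, and there are only finitely many subsets of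
  \<open>C\<close>.\<close>

lemma finite_if_separated_by_finite:
  fixes Z C :: "'a::linorder set"
  assumes "finite C" and sep: "\<And>a b. a \<in> Z \<Longrightarrow> b \<in> Z \<Longrightarrow> a < b \<Longrightarrow> \<exists>c\<in>C. a < c \<and> c < b"
  shows "finite Z"
proof (rule inj_on_finite)
  show "inj_on (\<lambda>z. C \<inter> {..<z}) Z"
  proof (rule linorder_inj_onI)
    fix a b assume "a < b" "a \<in> Z" "b \<in> Z"
    then obtain c where "c \<in> C" "a < c" "c < b" using sep by blast
    then have "c \<in> C \<inter> {..<b}" "c \<notin> C \<inter> {..<a}" by auto
    then show "C \<inter> {..<a} \<noteq> C \<inter> {..<b}" by blast
  qed (rule linear)
  show "(\<lambda>z. C \<inter> {..<z}) ` Z \<subseteq> Pow C" by blast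
qed (use \<open>finite C\<close> in simp)

text \<open>The intermediate value theorem gives a zero, and the nonzero end values push it into the
  open interval.\<close>

lemma continuous_on_Icc_zero:
  fixes f :: "real \<Rightarrow> real"
  assumes "continuous_on {a..b} f" "f a < 0 \<and> 0 < f b \<or> f b < 0 \<and> 0 < f a" "a \<le> b"
  obtains z where "a < z" "z < b" "f z = 0"
proof -
  have "\<exists>z. a \<le> z \<and> z \<le> b \<and> f z = 0"
    using assms IVT'[of f a 0 b] IVT2'[of f b 0 a] by fastforce
  then show ?thesis
    using that assms(2) by (metis less_irrefl order_le_less)
qed

text \<open>The zeros of \<open>f\<close> together with the two endpoints serve as breakpoints;
  between consecutive ones \<open>f\<close> cannot change sign.\<close>

lemma piecewise_constant_on_interval_sign:
  fixes f :: "real \<Rightarrow> real"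
  assumes "a \<le> b" and cont: "continuous_on {a..b} f" and fin: "finite {t \<in> {a..b}. f t = 0}"
  shows "piecewise_constant_on_interval a b (\<lambda>t. if f t > 0 then c else d)"
proof -
  define S where "S = insert a (insert b {t \<in> {a..b}. f t = 0})"
  have S: "finite S" "S \<noteq> {}" "a \<in> S" "b \<in> S" "S \<subseteq> {a..b}"
    using fin \<open>a \<le> b\<close> by (auto simp: S_def)
  define xs where "xs = sorted_list_of_set S"
  \<comment> \<open>There is one piece fewer than there are breakpoints, hence none when
    \<open>a = b\<close>.\<close>
  define n where "n = length xs - 1"
  have set_xs: "set xs = S" and sorted: "sorted_wrt (<) xs"
    using S(1) by (simp_all add: xs_def)
  have len: "length xs = Suc n"
    using set_xs S(2) by (cases xs) (auto simp: n_def)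
  have less: "xs ! i < xs ! j" if "i < j" "j \<le> n" for i j
    using sorted_wrt_nth_less[OF sorted] that len by simp
  have in_S: "xs ! i \<in> S" if "i \<le> n" for i
    using set_xs len that nth_mem by fastforce
  have ex_nth: "\<exists>i\<le>n. xs ! i = t" if "t \<in> S" for t
    using that set_xs len by (metis in_set_conv_nth less_Suc_eq_le)
  have "xs ! 0 = a"
  proof -
    obtain i where "i \<le> n" "xs ! i = a" using ex_nth S(3) by blast
    moreover have "a \<le> xs ! 0" using in_S[of 0] S(5) by auto
    ultimately show ?thesis using less[of 0 i] by (cases "i = 0") auto
  qed
  moreover have "xs ! n = b"
  proof -
    obtain i where "i \<le> n" "xs ! i = b" using ex_nth S(4) by blast
    moreover have "xs ! n \<le> b" using in_S[of n] S(5) by auto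
    ultimately show ?thesis using less[of i n] by (cases "i = n") auto
  qed
  moreover have "(\<lambda>t. if f t > 0 then c else d) constant_on {xs ! i<..<xs ! Suc i}" if "i < n" for i
  proof -
    have gap: "t \<notin> S" if "xs ! i < t" "t < xs ! Suc i" for t
    proof
      assume "t \<in> S"
      then obtain j where "j \<le> n" "xs ! j = t" using ex_nth by blast
      consider "j < i" | "j = i" | "j = Suc i" | "Suc i < j" by linarith
      then show False
      proof cases
        case 1
        with less[of j i] \<open>i < n\<close> \<open>xs ! j = t\<close> that show False by simp
      next
        case 4
        with less[of "Suc i" j] \<open>j \<le> n\<close> \<open>xs ! j = t\<close> that show False by simp
      qed (use \<open>xs ! j = t\<close> that in auto)
    qed
    have sub: "{xs ! i..xs ! Suc i} \<subseteq> {a..b}"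
      using in_S[of i] in_S[of "Suc i"] \<open>i < n\<close> S(5) by auto
    have nz: "f t \<noteq> 0" if "xs ! i < t" "t < xs ! Suc i" for t
      using gap[OF that] that sub by (auto simp: S_def)
    have same: "f p > 0 \<longleftrightarrow> f q > 0"
      if "xs ! i < p" "p < xs ! Suc i" "xs ! i < q" "q < xs ! Suc i" "p \<le> q" for p q
    proof (rule ccontr)
      assume "\<not> (f p > 0 \<longleftrightarrow> f q > 0)"
      then have "f p < 0 \<and> 0 < f q \<or> f q < 0 \<and> 0 < f p"
        using nz[of p] nz[of q] that by auto
      moreover have "continuous_on {p..q} f"
        using cont sub that by (intro continuous_on_subset[OF cont]) auto
      ultimately obtain z where "p < z" "z < q" "f z = 0"
        using continuous_on_Icc_zero \<open>p \<le> q\<close> by metis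
      then show False using nz[of z] that by auto
    qed
    \<comment> \<open>The midpoint is a reference point inside the piece whose sign fixes the
      constant value.\<close>
    define m where "m = (xs ! i + xs ! Suc i) / 2"
    have "xs ! i < m" "m < xs ! Suc i"
      using less[of i "Suc i"] \<open>i < n\<close> by (auto simp: m_def)
    then have eq: "f t > 0 \<longleftrightarrow> f m > 0" if "t \<in> {xs ! i<..<xs ! Suc i}" for t
      using same[of t m] same[of m t] that by (metis greaterThanLessThan_iff linear)
    show ?thesis
      unfolding constant_on_def
      by (intro exI[of _ "if f m > 0 then c else d"] ballI) (drule eq, simp only:)
  qed
  ultimately show ?thesis
    unfolding piecewise_constant_on_interval_def
    using less by (intro exI[of _ n] exI[of _ "\<lambda>i. xs ! i"]) auto
qed

section \<open>The edge control system\<close>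

text \<open>The bounds on state and control give \<open>\<bar>sqrt 3 * x\<bar> < 1\<close> and
  \<open>\<bar>2 * w\<bar> \<le> 1\<close>, so the product cannot reach \<open>1\<close>.\<close>

lemma edge_denominator_neg:
  assumes "- 1 / sqrt 3 < x" "x < 1 / sqrt 3" "w \<in> {-1/2..1/2}"
  shows "- 1 + 2 * sqrt 3 * x * w < 0"
proof -
  have "\<bar>sqrt 3 * x\<bar> < 1"
    using assms(1,2) by (simp add: field_simps abs_less_iff)
  moreover have "\<bar>2 * w\<bar> \<le> 1" using assms(3) by auto
  ultimately have "\<bar>sqrt 3 * x\<bar> * \<bar>2 * w\<bar> < 1"
    by (metis abs_ge_zero mult.right_neutral mult_left_mono order_le_less_trans)
  then have "\<bar>2 * sqrt 3 * x * w\<bar> < 1"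
    by (simp add: abs_mult mult_ac)
  then show ?thesis by linarith
qed

lemma edge_f2_strict_antimono:
  assumes x: "- 1 / sqrt 3 < x" "x < 1 / sqrt 3" and "y > 0"
    and v: "v \<in> {-1/2..1/2}" and w: "w \<in> {-1/2..1/2}" and "v < w"
  shows "edge_f2 x y w < edge_f2 x y v"
proof -
  note neg = edge_denominator_neg[OF x v] edge_denominator_neg[OF x w]
  \<comment> \<open>Both denominators are negative, so their product is positive. After
    cross-multiplication the terms in \<open>v * w\<close> cancel and \<open>v < w\<close>
    remains.\<close>
  have "w / (- 1 + 2 * sqrt 3 * x * w) < v / (- 1 + 2 * sqrt 3 * x * v)"
    using neg \<open>v < w\<close> by (simp add: divide_less_eq less_divide_eq algebra_simps)
  then have "(2 * sqrt 3 * y\<^sup>2) * (w / (- 1 + 2 * sqrt 3 * x * w))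
      < (2 * sqrt 3 * y\<^sup>2) * (v / (- 1 + 2 * sqrt 3 * x * v))"
    using \<open>y > 0\<close> by (intro mult_strict_left_mono) auto
  then show ?thesis by (simp add: edge_f2_def mult.assoc)
qed

text \<open>The control enters only through \<open>l2 * edge_f2 x y u\<close>, which is strictly
  monotone in it when \<open>l2\<close> is nonzero, so the maximum sits at an endpoint of the
  control interval.\<close>

lemma edge_hamiltonian_maximizer:
  assumes x: "- 1 / sqrt 3 < x" "x < 1 / sqrt 3" and "y > 0" and u: "u \<in> {-1/2..1/2}"
    and max: "\<forall>w\<in>{-1/2..1/2}. edge_hamiltonian s x y l1 l2 l3 lcost w
        \<le> edge_hamiltonian s x y l1 l2 l3 lcost u"
    and "l2 \<noteq> 0"
  shows "u = (if l2 > 0 then - 1/2 else 1/2)"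
proof -
  have le: "l2 * edge_f2 x y w \<le> l2 * edge_f2 x y u" if "w \<in> {-1/2..1/2}" for w
    using max that by (auto simp: edge_hamiltonian_def)
  note less = edge_f2_strict_antimono[OF x \<open>y > 0\<close>]
  show ?thesis
  proof (cases "l2 > 0")
    case True
    have "\<not> - 1/2 < u"
      using less[of "- 1/2" u] le[of "- 1/2"] u True by auto
    with u True show ?thesis by auto
  next
    case False
    have "\<not> u < 1/2"
      using less[of u "1/2"] le[of "1/2"] u False \<open>l2 \<noteq> 0\<close> by auto
    with u False show ?thesis by auto
  qed
qed

lemma deriv_edge_hamiltonian_s:
  "deriv (\<lambda>\<sigma>. edge_hamiltonian \<sigma> x y l1 l2 l3 lcost u) s = 0"
  by (simp add: edge_hamiltonian_def)

lemma deriv_edge_hamiltonian_y: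
  assumes "y \<noteq> 0"
  shows "deriv (\<lambda>\<eta>. edge_hamiltonian s x \<eta> l1 l2 l3 lcost u) y
    = l1 + 2 * l2 * edge_f2 x y u / y - (l3 + lcost * x\<^sup>2) / y\<^sup>2"
proof -
  \<comment> \<open>For fixed \<open>x\<close> and \<open>u\<close> the function
    \<open>edge_f2\<close> is \<open>k\<close> times the square of \<open>y\<close>, so its
    derivative in \<open>y\<close> is \<open>2 * edge_f2 x y u / y\<close>.\<close>
  define k where "k = 2 * sqrt 3 * u / (- 1 + 2 * sqrt 3 * x * u)"
  have f2: "edge_f2 x \<eta> u = \<eta>\<^sup>2 * k" for \<eta> by (simp add: edge_f2_def k_def)
  have "((\<lambda>\<eta>. l1 * \<eta> + l2 * (\<eta>\<^sup>2 * k) + l3 / \<eta> + lcost * (x\<^sup>2 / \<eta>)) has_real_derivative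
      l1 + 2 * l2 * (y\<^sup>2 * k) / y - (l3 + lcost * x\<^sup>2) / y\<^sup>2) (at y)"
    using assms by (auto intro!: derivative_eq_intros simp: field_simps power2_eq_square)
  then show ?thesis
    unfolding edge_hamiltonian_def edge_running_cost_def f2 by (rule DERIV_imp_deriv)
qed

lemma finite_quadratic_zeros:
  fixes p q :: real
  assumes "(p, q) \<noteq> (0, 0)"
  shows "finite {z. p + q * z\<^sup>2 = 0}"
proof (cases "q = 0")
  case False
  \<comment> \<open>If \<open>- p / q\<close> is negative, the left-hand set is empty and the
    inclusion is vacuous.\<close>
  have "{z. p + q * z\<^sup>2 = 0} \<subseteq> {sqrt (- p / q), - sqrt (- p / q)}"
  proof
    fix z assume "z \<in> {z. p + q * z\<^sup>2 = 0}"
    then have "z\<^sup>2 = - p / q" using False by (simp add: field_simps)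
    then have "sqrt (- p / q) = \<bar>z\<bar>" by (metis real_sqrt_abs)
    then show "z \<in> {sqrt (- p / q), - sqrt (- p / q)}" by auto
  qed
  then show ?thesis by (rule finite_subset) simp
qed (use assms in simp)

section \<open>Finiteness of the switches along an extremal\<close>

theorem theorem8p1p4:
  fixes t0 t1 lcost :: real
    and P0 P1 :: "real \<times> real \<times> real"
    and s x y l1 l2 l3 u :: "real \<Rightarrow> real"
  assumes "t0 \<le> t1"
    and "edge_extremal t0 t1 P0 P1 s x y l1 l2 l3 lcost u"
  shows "\<exists>v :: real \<Rightarrow> real.
           (\<forall>t\<in>{t0..t1}. v t = 1/2 \<or> v t = - 1/2) \<and>
           piecewise_constant_on_interval t0 t1 v \<and>
           (AE t in lebesgue_on {t0..t1}. u t = v t)"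
proof (cases "t0 = t1")
  case True
  \<comment> \<open>A single point is a null set, so a constant control with no pieces
    suffices.\<close>
  have "AE t in lebesgue_on {t0..t1}. u t = 1/2"
    using True by (intro AE_I'[of "{t0}"])
      (auto simp: null_sets_restrict_space negligible_iff_null_sets[symmetric])
  moreover have "piecewise_constant_on_interval t0 t1 (\<lambda>_. 1/2)"
    unfolding piecewise_constant_on_interval_def
    using True by (intro exI[of _ 0] exI[of _ "\<lambda>_. t0"]) auto
  ultimately show ?thesis by (intro exI[of _ "\<lambda>_. 1/2"]) auto
next
  case False
  with \<open>t0 \<le> t1\<close> have "t0 < t1" by simp
  define H where "H t = edge_hamiltonian (s t) (x t) (y t) (l1 t) (l2 t) (l3 t) lcost" for t
  have state: "y t > 0" "- 1 / sqrt 3 < x t" "x t < 1 / sqrt 3" "u t \<in> {-1/2..1/2}"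
    if "t \<in> {t0..t1}" for t
    using assms(2) that unfolding edge_extremal_def edge_trajectory_def by blast+
  have ac: "abs_continuous_on_interval t0 t1 x" "abs_continuous_on_interval t0 t1 y"
      "abs_continuous_on_interval t0 t1 l1" "abs_continuous_on_interval t0 t1 l2"
      "abs_continuous_on_interval t0 t1 l3"
    and nontriv: "\<And>t. t \<in> {t0..t1} \<Longrightarrow> (l1 t, l2 t, l3 t, lcost) \<noteq> (0, 0, 0, 0)"
    using assms(2) unfolding edge_extremal_def edge_trajectory_def by blast+
  \<comment> \<open>The almost everywhere conditions are merged so that one negligible set
    \<open>N\<close> serves all later steps.\<close>
  have "AE t in lebesgue_on {t0..t1}.
        (x has_real_derivative y t) (at t within {t0..t1}) \<and>
        (y has_real_derivative edge_f2 (x t) (y t) (u t)) (at t within {t0..t1}) \<and>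
        (l2 has_real_derivative
           - deriv (\<lambda>\<eta>. edge_hamiltonian (s t) (x t) \<eta> (l1 t) (l2 t) (l3 t) lcost (u t)) (y t))
          (at t within {t0..t1}) \<and>
        (l3 has_real_derivative 0) (at t within {t0..t1}) \<and>
        (\<forall>w\<in>{-1/2..1/2}. H t w \<le> H t (u t)) \<and> H t (u t) = 0"
    (is "AE t in _. ?good t")
  proof -
    have "AE t in lebesgue_on {t0..t1}.
        (s has_real_derivative 1 / y t) (at t within {t0..t1}) \<and>
        (x has_real_derivative y t) (at t within {t0..t1}) \<and>
        (y has_real_derivative edge_f2 (x t) (y t) (u t)) (at t within {t0..t1})"
      using assms(2) unfolding edge_extremal_def edge_trajectory_def by (elim conjE)
    moreover have "AE t in lebesgue_on {t0..t1}.
        (l1 has_real_derivative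
           - deriv (\<lambda>\<xi>. edge_hamiltonian (s t) \<xi> (y t) (l1 t) (l2 t) (l3 t) lcost (u t)) (x t))
          (at t within {t0..t1}) \<and>
        (l2 has_real_derivative
           - deriv (\<lambda>\<eta>. edge_hamiltonian (s t) (x t) \<eta> (l1 t) (l2 t) (l3 t) lcost (u t)) (y t))
          (at t within {t0..t1}) \<and>
        (l3 has_real_derivative
           - deriv (\<lambda>\<sigma>. edge_hamiltonian \<sigma> (x t) (y t) (l1 t) (l2 t) (l3 t) lcost (u t)) (s t))
          (at t within {t0..t1})"
      using assms(2) unfolding edge_extremal_def by (elim conjE)
    moreover have "AE t in lebesgue_on {t0..t1}.
        (\<forall>w\<in>{-1/2..1/2}. H t w \<le> H t (u t)) \<and> H t (u t) = 0"
      using assms(2) unfolding edge_extremal_def H_def by (elim conjE)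
    ultimately show ?thesis
      unfolding deriv_edge_hamiltonian_s minus_zero by eventually_elim (elim conjE, intro conjI)
  qed
  then obtain N where "N \<in> null_sets (lebesgue_on {t0..t1})"
    and sub: "{t \<in> space (lebesgue_on {t0..t1}). \<not> ?good t} \<subseteq> N"
    unfolding eventually_ae_filter by (elim bexE)
  then have N: "negligible N"
    by (simp add: null_sets_restrict_space negligible_iff_null_sets)
  have good: "?good t" if "t \<in> {t0..t1} - N" for t
  proof (rule ccontr)
    assume "\<not> ?good t"
    moreover have "t \<in> space (lebesgue_on {t0..t1})" using that by simp
    ultimately have "t \<in> N" by (intro subsetD[OF sub] CollectI conjI)
    then show False using that by simp
  qed
  have l3_const: "l3 t = l3 t0" if "t \<in> {t0..t1}" for t
  proof (rule abs_continuous_deriv_zero_imp_eq[of t0 t l3, OF _ _ N, symmetric])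
    show "(l3 has_real_derivative 0) (at r within {t0..t})" if "r \<in> {t0..t} - N" for r
      using good[of r] that \<open>t \<in> _\<close> by (auto intro: has_field_derivative_subset)
  qed (use that ac abs_continuous_on_interval_subset in auto)
  have x_less: "x a < x b" if "t0 \<le> a" "a < b" "b \<le> t1" for a b
  proof (rule abs_continuous_deriv_pos_imp_less[of a b x, OF _ _ N])
    show "\<exists>D>0. (x has_real_derivative D) (at r within {a..b})" if "r \<in> {a..b} - N" for r
      using good[of r] state(1)[of r] that \<open>t0 \<le> a\<close> \<open>b \<le> t1\<close>
      by (auto intro!: exI[of _ "y r"] intro: has_field_derivative_subset)
  qed (use that ac abs_continuous_on_interval_subset in auto)
  then have x_inj: "inj_on x {t0..t1}"
    unfolding inj_on_def by (metis atLeastAtMost_iff less_irrefl linorder_neqE)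

  \<comment> \<open>\<open>\<mu>\<close> has the sign of the switching function \<open>l2\<close>. The factor \<open>y\<close> is chosen so that,
    after eliminating \<open>l1\<close> by \<open>H = 0\<close>, the control drops out of the derivative of \<open>\<mu>\<close>.\<close>
  define g where "g t = l3 t0 + lcost * (x t)\<^sup>2" for t
  define \<mu> where "\<mu> t = l2 t * y t" for t
  have \<mu>_ac: "abs_continuous_on_interval t0 t1 \<mu>"
    unfolding \<mu>_def using ac by (intro abs_continuous_on_interval_mult)
  have \<mu>_deriv: "(\<mu> has_real_derivative 2 * g t / y t) (at t within {t0..t1})"
    if "t \<in> {t0..t1} - N" for t
  proof -
    have t: "t \<in> {t0..t1}" and "y t > 0" using that state(1) by auto
    define F where "F = edge_f2 (x t) (y t) (u t)"
    have H0: "l1 t * y t + l2 t * F + g t / y t = 0"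
      using good[OF that] l3_const[OF t]
      by (simp add: H_def edge_hamiltonian_def edge_running_cost_def F_def g_def add_divide_distrib)
    have "(l2 has_real_derivative - (l1 t + 2 * l2 t * F / y t - g t / (y t)\<^sup>2)) (at t within {t0..t1})"
      using good[OF that] l3_const[OF t] \<open>y t > 0\<close>
      by (simp add: deriv_edge_hamiltonian_y F_def g_def)
    then have "(\<mu> has_real_derivative - (l1 t + 2 * l2 t * F / y t - g t / (y t)\<^sup>2) * y t + F * l2 t)
        (at t within {t0..t1})"
      unfolding \<mu>_def using good[OF that] F_def by (intro DERIV_mult) auto
    moreover have "- (l1 t + 2 * l2 t * F / y t - g t / (y t)\<^sup>2) * y t + F * l2 t = 2 * g t / y t"
    proof -
      \<comment> \<open>The first bracket on the right is the Hamiltonian as written in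
        \<open>H0\<close>, hence zero.\<close>
      have "- (l1 t + 2 * l2 t * F / y t - g t / (y t)\<^sup>2) * y t + F * l2 t
          = - (l1 t * y t + l2 t * F + g t / y t) + 2 * g t / y t"
        using \<open>y t > 0\<close> by (simp add: field_simps power2_eq_square)
      with H0 show ?thesis by simp
    qed
    ultimately show ?thesis by simp
  qed
  have \<mu>_sub: "abs_continuous_on_interval a b \<mu>"
    "\<And>t. t \<in> {a..b} - N \<Longrightarrow> (\<mu> has_real_derivative 2 * g t / y t) (at t within {a..b})"
    if "t0 \<le> a" "b \<le> t1" for a b
  proof -
    show "abs_continuous_on_interval a b \<mu>"
      using abs_continuous_on_interval_subset[OF \<mu>_ac that] .
    show "(\<mu> has_real_derivative 2 * g t / y t) (at t within {a..b})" if "t \<in> {a..b} - N" for t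
    proof (rule has_field_derivative_subset[OF \<mu>_deriv])
      show "t \<in> {t0..t1} - N" "{a..b} \<subseteq> {t0..t1}"
        using that \<open>t0 \<le> a\<close> \<open>b \<le> t1\<close> by simp_all
    qed
  qed

  have fin: "finite {t \<in> {t0..t1}. \<mu> t = 0}"
  proof (cases "(l3 t0, lcost) = (0, 0)")
    case True
    then have "g t = 0" for t by (simp add: g_def)
    then have \<mu>_const: "\<mu> t0 = \<mu> t" if "t \<in> {t0..t1}" for t
      using abs_continuous_deriv_zero_imp_eq[OF _ \<mu>_sub(1) N] \<mu>_sub(2) that by simp
    have "\<mu> t0 \<noteq> 0"
    proof
      assume "\<mu> t0 = 0"
      \<comment> \<open>The vanishing of the Hamiltonian is available only off \<open>N\<close>. At
        such a point it reduces to \<open>l1 t * y t = 0\<close>, which contradicts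
        nontriviality.\<close>
      obtain t where "t0 < t" "t < t1" "t \<notin> N"
        using Ioo_diff_negligible_nonempty[OF \<open>t0 < t1\<close> N] by metis
      then have t: "t \<in> {t0..t1}" "t \<in> {t0..t1} - N" by auto
      have "l2 t = 0" "l3 t = 0"
        using \<mu>_const[OF t(1)] \<open>\<mu> t0 = 0\<close> state(1)[OF t(1)] l3_const[OF t(1)] True
        by (auto simp: \<mu>_def)
      moreover from this have "l1 t = 0"
        using good[OF t(2)] True state(1)[OF t(1)] by (simp add: H_def edge_hamiltonian_def)
      ultimately show False using nontriv[OF t(1)] True by simp
    qed
    then have "{t \<in> {t0..t1}. \<mu> t = 0} = {}" using \<mu>_const by auto
    then show ?thesis by (metis finite.emptyI)
  next
    case False
    \<comment> \<open>Zeros of \<open>g\<close> are preimages under the injective \<open>x\<close>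
      of the roots of a nonzero polynomial.\<close>
    have "finite {t \<in> {t0..t1}. g t = 0}"
    proof (rule finite_subset)
      show "{t \<in> {t0..t1}. g t = 0} \<subseteq> x -` {z. l3 t0 + lcost * z\<^sup>2 = 0} \<inter> {t0..t1}"
        by (auto simp: g_def)
    qed (intro finite_vimage_IntI finite_quadratic_zeros False x_inj)
    then show ?thesis
    \<comment> \<open>As in Rolle's theorem, two zeros of \<mu> must enclose a zero of
      \<open>g\<close>; otherwise \<open>g\<close> keeps one sign between them and \<mu> is strictly
      monotone.\<close>
    proof (rule finite_if_separated_by_finite)
      fix a b assume "a \<in> {t \<in> {t0..t1}. \<mu> t = 0}" "b \<in> {t \<in> {t0..t1}. \<mu> t = 0}" "a < b"
      then have ab: "t0 \<le> a" "a < b" "b \<le> t1" "\<mu> a = 0" "\<mu> b = 0" by auto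
      show "\<exists>c\<in>{t \<in> {t0..t1}. g t = 0}. a < c \<and> c < b"
      proof (rule ccontr)
        assume "\<not> ?thesis"
        then have nz: "g t \<noteq> 0" if "a < t" "t < b" for t using that ab by auto
        have g_cont: "continuous_on {t0..t1} g"
          unfolding g_def using abs_continuous_on_interval_imp_continuous_on[OF ac(1)]
          by (intro continuous_intros)
        have same: "\<not> (g p < 0 \<and> 0 < g q \<or> g q < 0 \<and> 0 < g p)"
          if "a < p" "p \<le> q" "q < b" for p q
        proof
          assume *: "g p < 0 \<and> 0 < g q \<or> g q < 0 \<and> 0 < g p"
          have "continuous_on {p..q} g"
            using that ab by (intro continuous_on_subset[OF g_cont]) auto
          then obtain z where "p < z" "z < q" "g z = 0"
            using continuous_on_Icc_zero * \<open>p \<le> q\<close> by metis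
          then show False using nz[of z] that by auto
        qed
        define m where "m = (a + b) / 2"
        have m: "a < m" "m < b" using ab by (auto simp: m_def)
        note D = \<mu>_sub[OF ab(1,3)]
        \<comment> \<open>At \<open>a\<close> and \<open>b\<close> themselves \<open>g\<close> may
          vanish, so these two points join the exceptional set.\<close>
        define N' where "N' = N \<union> {a, b}"
        have N': "negligible N'" using N by (simp add: N'_def)
        show False
        proof (cases "g m > 0")
          case True
          have "g t > 0" if "a < t" "t < b" for t
            using same[of t m] same[of m t] nz[OF that] True m that by (cases "t \<le> m") auto
          then have "\<exists>D>0. (\<mu> has_real_derivative D) (at t within {a..b})" if "t \<in> {a..b} - N'" for t
            using D(2)[of t] that ab state(1)[of t]
            by (intro exI[of _ "2 * g t / y t"]) (auto simp: N'_def)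
          then have "\<mu> a < \<mu> b"
            by (rule abs_continuous_deriv_pos_imp_less[OF \<open>a < b\<close> D(1) N'])
          with ab show False by simp
        next
          case False
          then have "g m < 0" using nz[OF m] by simp
          have "g t < 0" if "a < t" "t < b" for t
            using same[of t m] same[of m t] nz[OF that] \<open>g m < 0\<close> m that by (cases "t \<le> m") auto
          then have "\<exists>D>0. ((\<lambda>t. - \<mu> t) has_real_derivative D) (at t within {a..b})"
            if "t \<in> {a..b} - N'" for t
            using DERIV_minus[OF D(2)[of t]] that ab state(1)[of t]
            by (intro exI[of _ "- (2 * g t / y t)"]) (auto simp: N'_def divide_less_0_iff)
          then have "- \<mu> a < - \<mu> b"
            by (rule abs_continuous_deriv_pos_imp_less
                [OF \<open>a < b\<close> abs_continuous_on_interval_minus[OF D(1)] N'])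
          with ab show False by simp
        qed
      qed
    qed
  qed

  \<comment> \<open>Since \<open>y\<close> is positive, this is the maximizing control wherever
    \<open>l2\<close> is nonzero. At the zeros the value \<open>1/2\<close> is arbitrary, as they
    form a finite and therefore null set.\<close>
  define v :: "real \<Rightarrow> real" where "v t = (if \<mu> t > 0 then - 1/2 else 1/2)" for t
  have "piecewise_constant_on_interval t0 t1 v"
    unfolding v_def
    using \<open>t0 \<le> t1\<close> abs_continuous_on_interval_imp_continuous_on[OF \<mu>_ac] fin
    by (rule piecewise_constant_on_interval_sign)
  moreover have "AE t in lebesgue_on {t0..t1}. u t = v t"
  proof (rule AE_I')
    show "{t \<in> space (lebesgue_on {t0..t1}). u t \<noteq> v t}
        \<subseteq> (N \<union> {t \<in> {t0..t1}. \<mu> t = 0}) \<inter> {t0..t1}"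
    proof
      fix t assume "t \<in> {t \<in> space (lebesgue_on {t0..t1}). u t \<noteq> v t}"
      then have t: "t \<in> {t0..t1}" and "u t \<noteq> v t" by (auto simp: space_restrict_space)
      have "u t = v t" if "t \<notin> N" "\<mu> t \<noteq> 0"
      proof -
        have "l2 t \<noteq> 0" "l2 t > 0 \<longleftrightarrow> \<mu> t > 0"
          using that(2) state(1)[OF t] by (auto simp: \<mu>_def zero_less_mult_iff)
        moreover have "u t = (if l2 t > 0 then - 1/2 else 1/2)"
        proof (rule edge_hamiltonian_maximizer)
          show "\<forall>w\<in>{-1/2..1/2}. edge_hamiltonian (s t) (x t) (y t) (l1 t) (l2 t) (l3 t) lcost w
              \<le> edge_hamiltonian (s t) (x t) (y t) (l1 t) (l2 t) (l3 t) lcost (u t)"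
            using good[of t] t that(1) unfolding H_def by blast
        qed (fact state[OF t] \<open>l2 t \<noteq> 0\<close>)+
        ultimately show ?thesis by (simp only: v_def)
      qed
      with \<open>u t \<noteq> v t\<close> t show "t \<in> (N \<union> {t \<in> {t0..t1}. \<mu> t = 0}) \<inter> {t0..t1}" by auto
    qed
    have "negligible ((N \<union> {t \<in> {t0..t1}. \<mu> t = 0}) \<inter> {t0..t1})"
      using N negligible_finite[OF fin] by (intro negligible_Int negligible_Un disjI1)
    then show "(N \<union> {t \<in> {t0..t1}. \<mu> t = 0}) \<inter> {t0..t1} \<in> null_sets (lebesgue_on {t0..t1})"
      by (simp add: null_sets_restrict_space negligible_iff_null_sets)
  qed
  ultimately show ?thesis
    by (intro exI[of _ v]) (auto simp: v_def)
qed

end
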